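(* Let $G$ be a finite group of order at least $2$. Then $\alpha(G)\leq \chi(G)$. Moreover, if $\alpha(G)=\chi(G)$, then all of the following assertions hold: (i) for any subgroup $H$ of $G$, $\gamma(H)=\chi(H)$; (ii) every nonidentity element of $G$ has prime order; (iii) $G$ is nilpotent if and only if $G$ is (isomorphic to) the direct product of $\chi(G)$ copies of a cyclic group of prime order.
   Context: A subset $D$ of a group $G$ is a determining set of $G$ if the only automorphism of $G$ that fixes every element of $D$ is the identity automorphism. The determining number $\alpha(G)$ is the cardinality of a smallest determining set of $G$ ($\alpha(G)=0$ if $G$ has only the identity automorphism). The generating number $\gamma(G)$ is the cardinality of a smallest generating set of $G$ (the trivial group has generating number $0$). For a finite group $G$, $\chi(G)$ denotes the number of prime divisors of $|G|$ counted with multiplicity: if $|G|=p_1^{m_1}p_2^{m_2}\cdots p_s^{m_s}$ with $p_1,\ldots,p_s$ distinct primes, then $\chi(G)=m_1+m_2+\cdots+m_s$ (and $\chi$ of the trivial group is $0$). *)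

theory Defs
  imports
    "HOL-Computational_Algebra.Primes"
    "HOL-Algebra.Bij"
    "HOL-Algebra.Generated_Groups"
    "HOL-Algebra.Multiplicative_Group"
    "HOL-Algebra.Product_Groups"
begin

text \<open>Elements of \<open>auto G\<close> are extensional (\<open>undefined\<close> outside the carrier), so the identity
  automorphism is the restricted identity function.\<close>

definition determining_set :: "('a, 'b) monoid_scheme \<Rightarrow> 'a set \<Rightarrow> bool" where
  "determining_set G D \<longleftrightarrow>
     D \<subseteq> carrier G \<and>
     (\<forall>\<phi> \<in> auto G. (\<forall>d \<in> D. \<phi> d = d) \<longrightarrow> \<phi> = (\<lambda>x \<in> carrier G. x))"

text \<open>The two numbers below are only meaningful if a finite determining (generating) set exists, as
  is the case for finite groups; finiteness is required because \<open>card\<close> is \<open>0\<close> on infinite sets.\<close>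

definition determining_number :: "('a, 'b) monoid_scheme \<Rightarrow> nat" where
  "determining_number G = (LEAST n. \<exists>D. determining_set G D \<and> finite D \<and> card D = n)"

definition generating_number :: "('a, 'b) monoid_scheme \<Rightarrow> nat" where
  "generating_number G =
     (LEAST n. \<exists>S. S \<subseteq> carrier G \<and> generate G S = carrier G \<and> finite S \<and> card S = n)"

definition chi :: "('a, 'b) monoid_scheme \<Rightarrow> nat" where
  "chi G = (\<Sum>p \<in> prime_factors (order G). multiplicity p (order G))"

text \<open>Lower central series: \<open>\<gamma>\<^sub>0 = G\<close> and \<open>\<gamma>\<^sub>n\<^sub>+\<^sub>1 = [\<gamma>\<^sub>n, G]\<close>.\<close>

primrec lower_central :: "('a, 'b) monoid_scheme \<Rightarrow> nat \<Rightarrow> 'a set" where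
  "lower_central G 0 = carrier G"
| "lower_central G (Suc n) =
     generate G {x \<otimes>\<^bsub>G\<^esub> y \<otimes>\<^bsub>G\<^esub> inv\<^bsub>G\<^esub> x \<otimes>\<^bsub>G\<^esub> inv\<^bsub>G\<^esub> y | x y.
                 x \<in> lower_central G n \<and> y \<in> carrier G}"

definition nilpotent_group :: "('a, 'b) monoid_scheme \<Rightarrow> bool" where
  "nilpotent_group G \<longleftrightarrow> group G \<and> (\<exists>n. lower_central G n = {\<one>\<^bsub>G\<^esub>})"

end

theory Submission
  imports Defs
begin

text \<open>
  An automorphism is determined by its values on a generating set, so \<open>\<alpha>(G) \<le> \<gamma>(G)\<close>. Adjoining one
  new generator at a time enlarges the generated subgroup each time, and by Lagrange a proper
  enlargement raises \<open>\<chi>\<close> by at least one. Starting this process from a subgroup \<open>H\<close> instead of from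
  the trivial group gives the inequality
  \<open>\<gamma>(G) + \<chi>(H) \<le> \<gamma>(H) + \<chi>(G)\<close> (\<open>generating_number_le_subgroup\<close>), which carries the whole result.
  With \<open>H\<close> trivial it says \<open>\<gamma>(G) \<le> \<chi>(G)\<close>, hence \<open>\<alpha>(G) \<le> \<chi>(G)\<close>. If \<open>\<alpha>(G) = \<chi>(G)\<close>, then
  \<open>\<gamma>(G) = \<chi>(G)\<close>, and the inequality yields \<open>\<chi>(H) \<le> \<gamma>(H)\<close> for every subgroup \<open>H\<close>, which is (i).
  Applied to a cyclic subgroup this gives \<open>\<chi> \<le> 1\<close>, which is (ii).

  For (iii), every subgroup generated by two elements has \<open>\<chi> \<le> 2\<close>. A nilpotent group with \<open>\<chi> \<le> 2\<close> is
  abelian (\<open>nilpotent_chi_le_2_commutes\<close>): otherwise, for a noncentral \<open>x\<close>, the trivial group, the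
  centre, the centralizer of \<open>x\<close> and the whole group would form a strictly increasing chain of four
  subgroups. So a nilpotent \<open>G\<close> is abelian. By (ii) all its nonidentity elements have prime order, and
  these primes agree, because a product of commuting elements of distinct prime orders has composite
  order. Thus \<open>G\<close> is an elementary abelian \<open>p\<close>-group with \<open>\<gamma>(G) = \<chi>(G) = n\<close>; a minimal generating
  set defines a surjection from the product of \<open>n\<close> cyclic groups of order \<open>p\<close> onto \<open>G\<close>, and both
  groups have order \<open>p\<^sup>n\<close>. Conversely, such a product is abelian, hence nilpotent.
\<close>

section \<open>Subgroups and the number of prime divisors of the order\<close>

lemma chi_eq_size: "chi G = size (prime_factorization (order G))"
  unfolding chi_def size_multiset_overloaded_eq
  by (intro sum.cong) (auto simp: count_prime_factorization in_prime_factors_imp_prime)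

lemma size_prime_factorization_strict_mono:
  fixes a b :: nat
  assumes "a dvd b" "a < b"
  shows "size (prime_factorization a) < size (prime_factorization b)"
proof -
  obtain c where c: "b = a * c" using assms by blast
  have nz: "a \<noteq> 0" "c \<noteq> 0" and "c \<noteq> 1" using assms c by auto
  then have "prime_factorization c \<noteq> {#}"
    by (simp add: prime_factorization_empty_iff)
  then show ?thesis
    by (simp add: c prime_factorization_mult[OF nz] nonempty_has_size)
qed

lemma (in group) chi_subgroup_strict_mono:
  assumes fin: "finite (carrier G)" and K: "subgroup K G" and H: "subgroup H G" and "K \<subset> H"
  shows "chi (G\<lparr>carrier := K\<rparr>) < chi (G\<lparr>carrier := H\<rparr>)"
proof -
  interpret H: group "G\<lparr>carrier := H\<rparr>" using subgroup.subgroup_is_group[OF H is_group] .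
  have "subgroup K (G\<lparr>carrier := H\<rparr>)" using subgroup_incl[OF K H] \<open>K \<subset> H\<close> by auto
  from H.lagrange[OF this] have "card K dvd card H"
    by (simp add: order_def) (metis dvd_triv_right)
  moreover have "card K < card H"
    using \<open>K \<subset> H\<close> finite_subset[OF subgroup.subset[OF H] fin] by (simp add: psubset_card_mono)
  ultimately show ?thesis
    by (simp add: chi_eq_size order_def size_prime_factorization_strict_mono)
qed

section \<open>Generating sets and determining sets\<close>

text \<open>Each generator adjoined outside the subgroup generated so far raises \<open>\<chi>\<close> of that subgroup by at
  least one, so at most \<open>\<chi>(G) - \<chi>(\<langle>S\<rangle>)\<close> of them are needed to reach \<open>G\<close>. The bound is written
  additively to avoid truncated subtraction.\<close>

lemma (in group) extend_generating_set:
  assumes fin: "finite (carrier G)" and "finite S" "S \<subseteq> carrier G"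
  shows "\<exists>T. finite T \<and> T \<subseteq> carrier G \<and> generate G T = carrier G \<and>
    card T + chi (G\<lparr>carrier := generate G S\<rparr>) \<le> card S + chi G"
  using assms(2,3)
proof (induction "card (carrier G) - card (generate G S)" arbitrary: S rule: less_induct)
  case less
  let ?H = "generate G S"
  have H: "subgroup ?H G" using less.prems generate_is_subgroup by blast
  show ?case
  proof (cases "?H = carrier G")
    case True
    then show ?thesis using less.prems by (intro exI[of _ S]) simp
  next
    case False
    then obtain x where x: "x \<in> carrier G" "x \<notin> ?H" using subgroup.subset[OF H] by blast
    let ?S = "insert x S"
    let ?K = "generate G ?S"
    have S: "finite ?S" "?S \<subseteq> carrier G" using less.prems x by auto
    have K: "subgroup ?K G" using S generate_is_subgroup by blast
    have "x \<in> ?K" by (simp add: generate.incl)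
    then have HK: "?H \<subset> ?K" using x mono_generate[of S ?S] by auto
    have finK: "finite ?K" using subgroup.subset[OF K] fin finite_subset by blast
    have "card ?H < card ?K" using HK finK by (simp add: psubset_card_mono)
    moreover have "card ?K \<le> card (carrier G)" using subgroup.subset[OF K] fin by (simp add: card_mono)
    ultimately have "card (carrier G) - card ?K < card (carrier G) - card ?H" by simp
    from less.hyps[OF this S] obtain T where T: "finite T" "T \<subseteq> carrier G" "generate G T = carrier G"
      "card T + chi (G\<lparr>carrier := ?K\<rparr>) \<le> card ?S + chi G" by blast
    moreover have "chi (G\<lparr>carrier := ?H\<rparr>) < chi (G\<lparr>carrier := ?K\<rparr>)"
      by (rule chi_subgroup_strict_mono[OF fin H K HK])
    moreover have "card ?S \<le> card S + 1" using less.prems by (simp add: card_insert_if)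
    ultimately show ?thesis by (intro exI[of _ T]) linarith
  qed
qed

lemma generating_number_le:
  assumes "S \<subseteq> carrier G" "generate G S = carrier G" "finite S"
  shows "generating_number G \<le> card S"
  unfolding generating_number_def using assms by (intro Least_le) blast

lemma (in group) generating_number_attained:
  assumes "finite (carrier G)"
  obtains S where "S \<subseteq> carrier G" "generate G S = carrier G" "finite S" "card S = generating_number G"
proof -
  have "generate G (carrier G) = carrier G"
    using generate_incl[of "carrier G"] generate.incl[of _ "carrier G" G] by blast
  then have "\<exists>n S. S \<subseteq> carrier G \<and> generate G S = carrier G \<and> finite S \<and> card S = n"
    using assms by blast
  from LeastI_ex[OF this] show thesis
    using that unfolding generating_number_def by blast
qed

text \<open>A minimal generating set of \<open>H\<close> is extended to one of \<open>G\<close>.\<close>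

lemma (in group) generating_number_le_subgroup:
  assumes fin: "finite (carrier G)" and H: "subgroup H G"
  shows "generating_number G + chi (G\<lparr>carrier := H\<rparr>)
    \<le> generating_number (G\<lparr>carrier := H\<rparr>) + chi G"
proof -
  interpret H: group "G\<lparr>carrier := H\<rparr>" using subgroup.subgroup_is_group[OF H is_group] .
  have HG: "H \<subseteq> carrier G" using subgroup.subset[OF H] .
  then have "finite (carrier (G\<lparr>carrier := H\<rparr>))" using fin finite_subset by auto
  then obtain S where S: "S \<subseteq> H" "generate (G\<lparr>carrier := H\<rparr>) S = H" "finite S"
    "card S = generating_number (G\<lparr>carrier := H\<rparr>)"
    using H.generating_number_attained by auto
  have gen: "generate G S = H" using S generate_consistent[OF S(1) H] by simp
  obtain T where T: "finite T" "T \<subseteq> carrier G" "generate G T = carrier G"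
    "card T + chi (G\<lparr>carrier := H\<rparr>) \<le> card S + chi G"
    using extend_generating_set[OF fin S(3)] S(1) HG gen by force
  show ?thesis using generating_number_le[OF T(2,3,1)] T(4) S(4) by linarith
qed

lemma (in group) generating_number_le_chi:
  assumes fin: "finite (carrier G)"
  shows "generating_number G \<le> chi G"
proof -
  have "generate (G\<lparr>carrier := {\<one>}\<rparr>) {} = {\<one>}"
    using group.generate_empty[OF subgroup.subgroup_is_group[OF triv_subgroup is_group]] by simp
  then have "generating_number (G\<lparr>carrier := {\<one>}\<rparr>) \<le> card ({} :: 'a set)"
    by (intro generating_number_le) auto
  then show ?thesis using generating_number_le_subgroup[OF fin triv_subgroup] by simp
qed

text \<open>The elements fixed by an automorphism form a subgroup.\<close>

lemma (in group) determining_set_of_generating_set: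
  assumes "S \<subseteq> carrier G" "generate G S = carrier G"
  shows "determining_set G S"
  unfolding determining_set_def
proof (intro conjI ballI impI)
  fix \<phi> assume \<phi>: "\<phi> \<in> auto G" and fixed: "\<forall>d\<in>S. \<phi> d = d"
  have hom: "\<phi> \<in> hom G G" and ext: "\<phi> \<in> extensional (carrier G)"
    using \<phi> by (auto simp: auto_def Bij_def)
  interpret group_hom G G \<phi> by unfold_locales (rule hom)
  have "\<phi> x = x" if "x \<in> carrier G" for x
  proof -
    have "x \<in> generate G S" using that assms by simp
    then show ?thesis
    proof induction
      case (eng h1 h2)
      then show ?case using assms(2) by auto
    qed (use assms(1) fixed in \<open>auto simp: subset_iff\<close>)
  qed
  then show "\<phi> = (\<lambda>x\<in>carrier G. x)" using ext by (auto simp: extensional_def)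
qed (rule assms(1))

lemma (in group) determining_number_le_generating_number:
  assumes "finite (carrier G)"
  shows "determining_number G \<le> generating_number G"
proof -
  obtain S where "S \<subseteq> carrier G" "generate G S = carrier G" "finite S" "card S = generating_number G"
    using generating_number_attained[OF assms] .
  then show ?thesis
    unfolding determining_number_def
    by (intro Least_le) (use determining_set_of_generating_set in blast)
qed

section \<open>Groups whose generating number is maximal\<close>

text \<open>Cancelling \<open>\<gamma>(G) = \<chi>(G)\<close> from \<open>generating_number_le_subgroup\<close> leaves \<open>\<chi>(H) \<le> \<gamma>(H)\<close>, the
  reverse of the bound that holds in every finite group.\<close>

lemma (in group) generating_number_subgroup_eq_chi:
  assumes fin: "finite (carrier G)" and "generating_number G = chi G" and H: "subgroup H G"
  shows "generating_number (G\<lparr>carrier := H\<rparr>) = chi (G\<lparr>carrier := H\<rparr>)"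
proof -
  interpret H: group "G\<lparr>carrier := H\<rparr>" using subgroup.subgroup_is_group[OF H is_group] .
  have "finite (carrier (G\<lparr>carrier := H\<rparr>))"
    using fin subgroup.subset[OF H] finite_subset by auto
  then show ?thesis
    using H.generating_number_le_chi generating_number_le_subgroup[OF fin H] assms(2) by fastforce
qed

text \<open>For one generator this bounds \<open>\<chi>\<close> of cyclic subgroups, for two it bounds \<open>\<chi>\<close> of the subgroup in which two given
  elements can be compared.\<close>

lemma (in group) chi_generate_le_card:
  assumes fin: "finite (carrier G)" and "generating_number G = chi G"
    and S: "S \<subseteq> carrier G" "finite S"
  shows "chi (G\<lparr>carrier := generate G S\<rparr>) \<le> card S"
proof -
  let ?H = "generate G S"
  have H: "subgroup ?H G" using generate_is_subgroup[OF S(1)] .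
  have SH: "S \<subseteq> ?H" by (auto intro: generate.incl)
  have "generate (G\<lparr>carrier := ?H\<rparr>) S = ?H" using generate_consistent[OF SH H] by simp
  then have "generating_number (G\<lparr>carrier := ?H\<rparr>) \<le> card S"
    using SH S(2) by (intro generating_number_le) auto
  then show ?thesis using generating_number_subgroup_eq_chi[OF fin assms(2) H] by simp
qed

lemma (in group) prime_order_elements:
  assumes fin: "finite (carrier G)" and "generating_number G = chi G"
    and x: "x \<in> carrier G" "x \<noteq> \<one>"
  shows "Factorial_Ring.prime (ord x)"
proof -
  have "size (prime_factorization (ord x)) \<le> 1"
    using chi_generate_le_card[OF fin assms(2), of "{x}"] x(1)
    by (simp add: chi_eq_size order_def generate_pow_card)
  moreover have "ord x \<noteq> 1" using ord_eq_1 x by blast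
  moreover have pos: "ord x \<noteq> 0" using ord_ge_1[OF fin x(1)] by simp
  ultimately obtain p where p: "prime_factorization (ord x) = {#p#}"
    by (metis One_nat_def le_Suc_eq le_zero_eq nonempty_has_size not_gr_zero
        prime_factorization_empty_iff size_1_singleton_mset nat_dvd_1_iff_1)
  then have "Factorial_Ring.prime p" by (metis in_prime_factors_imp_prime set_mset_single singletonI)
  moreover have "ord x = p" using prod_mset_prime_factorization_nat[OF pos[unfolded neq0_conv]] p by simp
  ultimately show ?thesis by simp
qed

section \<open>Nilpotent groups\<close>

lemma (in group) lower_central_subset: "lower_central G n \<subseteq> carrier G"
proof (induction n)
  case (Suc n)
  then show ?case by (simp only: lower_central.simps) (rule generate_incl, blast)
qed simp

lemma (in group) one_in_lower_central: "\<one> \<in> lower_central G n"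
  by (cases n) (auto intro: generate.one)

lemma (in group) lower_central_subgroup_subset:
  assumes H: "subgroup H G"
  shows "lower_central (G\<lparr>carrier := H\<rparr>) n \<subseteq> lower_central G n"
proof (induction n)
  case 0
  then show ?case using subgroup.subset[OF H] by simp
next
  case (Suc n)
  interpret H: group "G\<lparr>carrier := H\<rparr>" using subgroup.subgroup_is_group[OF H is_group] .
  let ?C = "\<lambda>K A. {x \<otimes>\<^bsub>K\<^esub> y \<otimes>\<^bsub>K\<^esub> inv\<^bsub>K\<^esub> x \<otimes>\<^bsub>K\<^esub> inv\<^bsub>K\<^esub> y | x y. x \<in> A \<and> y \<in> carrier K}"
  let ?L = "lower_central (G\<lparr>carrier := H\<rparr>) n"
  have LH: "?L \<subseteq> H" using H.lower_central_subset[of n] by simp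
  have sub: "?C (G\<lparr>carrier := H\<rparr>) ?L \<subseteq> ?C G (lower_central G n)"
  proof
    fix c assume "c \<in> ?C (G\<lparr>carrier := H\<rparr>) ?L"
    then obtain x y where xy: "x \<in> ?L" "y \<in> H"
      and c: "c = x \<otimes> y \<otimes> inv\<^bsub>G\<lparr>carrier := H\<rparr>\<^esub> x \<otimes> inv\<^bsub>G\<lparr>carrier := H\<rparr>\<^esub> y" by auto
    have "c = x \<otimes> y \<otimes> inv x \<otimes> inv y" using c xy LH m_inv_consistent[OF H] by auto
    then show "c \<in> ?C G (lower_central G n)" using xy Suc subgroup.subset[OF H] by blast
  qed
  have CH: "?C (G\<lparr>carrier := H\<rparr>) ?L \<subseteq> H"
    using H.subgroup_self LH by (auto intro!: subgroup.m_closed[OF H] simp: subset_iff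
      dest: H.inv_closed[simplified])
  have "lower_central (G\<lparr>carrier := H\<rparr>) (Suc n) = generate G (?C (G\<lparr>carrier := H\<rparr>) ?L)"
    using generate_consistent[OF CH H] by simp
  also have "\<dots> \<subseteq> generate G (?C G (lower_central G n))" by (rule mono_generate[OF sub])
  finally show ?case by simp
qed

lemma (in group) nilpotent_subgroup:
  assumes "nilpotent_group G" and H: "subgroup H G"
  shows "nilpotent_group (G\<lparr>carrier := H\<rparr>)"
proof -
  interpret H: group "G\<lparr>carrier := H\<rparr>" using subgroup.subgroup_is_group[OF H is_group] .
  obtain n where "lower_central G n = {\<one>}" using assms(1) unfolding nilpotent_group_def by blast
  then have "lower_central (G\<lparr>carrier := H\<rparr>) n = {\<one>}"
    using lower_central_subgroup_subset[OF H, of n] H.one_in_lower_central[of n] by auto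
  then show ?thesis unfolding nilpotent_group_def using H.is_group by auto
qed

text \<open>Commutators of elements of the last nontrivial term of the lower central series with elements of
  \<open>G\<close> are trivial, so that term is central.\<close>

lemma (in group) nilpotent_central_element:
  assumes "nilpotent_group G" "carrier G \<noteq> {\<one>}"
  obtains z where "z \<in> carrier G" "z \<noteq> \<one>" "\<And>y. y \<in> carrier G \<Longrightarrow> z \<otimes> y = y \<otimes> z"
proof -
  have ex: "\<exists>n. lower_central G n = {\<one>}" using assms(1) unfolding nilpotent_group_def by blast
  define n where "n = (LEAST n. lower_central G n = {\<one>})"
  have n: "lower_central G n = {\<one>}" unfolding n_def by (rule LeastI_ex[OF ex])
  obtain m where m: "n = Suc m" using n assms(2) by (cases n) auto
  have "lower_central G m \<noteq> {\<one>}"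
    using not_less_Least[of m "\<lambda>n. lower_central G n = {\<one>}"] m unfolding n_def by auto
  then obtain z where z: "z \<in> lower_central G m" "z \<noteq> \<one>" using one_in_lower_central[of m] by blast
  have zG: "z \<in> carrier G" using z lower_central_subset by blast
  have "z \<otimes> y = y \<otimes> z" if y: "y \<in> carrier G" for y
  proof -
    have "z \<otimes> y \<otimes> inv z \<otimes> inv y \<in> lower_central G n"
      unfolding m lower_central.simps by (rule generate.incl) (use z y in blast)
    then have "z \<otimes> y \<otimes> inv z \<otimes> inv y = \<one>" using n by simp
    then have "z \<otimes> y \<otimes> inv z = y" using y zG inv_equality[of _ "inv y"] by (metis inv_closed inv_inv m_closed)
    then show ?thesis using y zG by (metis inv_solve_right m_closed)
  qed
  then show thesis using that zG z(2) by blast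
qed

lemma (in group) centralizer_subgroup:
  assumes A: "A \<subseteq> carrier G"
  shows "subgroup {h \<in> carrier G. \<forall>a\<in>A. h \<otimes> a = a \<otimes> h} G" (is "subgroup ?C G")
proof (rule subgroupI)
  show "?C \<noteq> {}" using A by (auto intro!: exI[of _ \<one>])
  show "inv h \<in> ?C" if "h \<in> ?C" for h
  proof -
    have h: "h \<in> carrier G" using that by simp
    have "inv h \<otimes> a = a \<otimes> inv h" if "a \<in> A" for a
    proof -
      have a: "a \<in> carrier G" and comm: "h \<otimes> a = a \<otimes> h" using that \<open>h \<in> ?C\<close> A by auto
      have "a \<otimes> inv h = inv h \<otimes> (h \<otimes> a) \<otimes> inv h" using a h by (simp add: m_assoc[symmetric])
      also have "\<dots> = inv h \<otimes> a" using a h unfolding comm by (simp add: m_assoc)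
      finally show ?thesis by simp
    qed
    then show ?thesis using h by simp
  qed
  show "h \<otimes> k \<in> ?C" if "h \<in> ?C" "k \<in> ?C" for h k
    using that A by (auto simp: m_assoc subset_iff) (metis m_assoc)
qed auto

text \<open>The chain \<open>1 < Z(G) < C(x) < G\<close> is strict if \<open>x\<close> is not central: \<open>Z(G) \<noteq> 1\<close> by nilpotency, and
  \<open>x\<close> lies in its own centralizer but not in the centre. It forces \<open>\<chi>(G) \<ge> 3\<close>.\<close>

lemma (in group) nilpotent_chi_le_2_commutes:
  assumes fin: "finite (carrier G)" and nil: "nilpotent_group G" and "chi G \<le> 2"
    and xy: "x \<in> carrier G" "y \<in> carrier G"
  shows "x \<otimes> y = y \<otimes> x"
proof (rule ccontr)
  assume nc: "x \<otimes> y \<noteq> y \<otimes> x"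
  define C where "C A = {h \<in> carrier G. \<forall>a\<in>A. h \<otimes> a = a \<otimes> h}" for A
  have C: "subgroup (C A) G" if "A \<subseteq> carrier G" for A
    using centralizer_subgroup[OF that] by (simp add: C_def)
  have "carrier G \<noteq> {\<one>}" using nc xy by force
  then obtain z where z: "z \<in> carrier G" "z \<noteq> \<one>" "\<And>y. y \<in> carrier G \<Longrightarrow> z \<otimes> y = y \<otimes> z"
    using nilpotent_central_element[OF nil] by blast
  \<comment> \<open>\<open>C (carrier G)\<close> is the centre, and \<open>C {x}\<close> the centralizer of \<open>x\<close>.\<close>
  have "{\<one>} \<subset> C (carrier G)" using z subgroup.one_closed[OF C] by (auto simp: C_def)
  moreover have "C (carrier G) \<subset> C {x}"
  proof
    show "C (carrier G) \<subseteq> C {x}" using xy by (auto simp: C_def)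
    have "x \<in> C {x}" "x \<notin> C (carrier G)" using xy nc by (auto simp: C_def)
    then show "C (carrier G) \<noteq> C {x}" by blast
  qed
  moreover have "C {x} \<subset> carrier G"
  proof
    show "C {x} \<subseteq> carrier G" by (auto simp: C_def)
    have "y \<notin> C {x}" using nc by (auto simp: C_def)
    then show "C {x} \<noteq> carrier G" using xy by blast
  qed
  moreover have "subgroup (C (carrier G)) G" "subgroup (C {x}) G" using C xy by auto
  ultimately have "chi (G\<lparr>carrier := {\<one>}\<rparr>) < chi (G\<lparr>carrier := C (carrier G)\<rparr>)"
    "chi (G\<lparr>carrier := C (carrier G)\<rparr>) < chi (G\<lparr>carrier := C {x}\<rparr>)"
    "chi (G\<lparr>carrier := C {x}\<rparr>) < chi (G\<lparr>carrier := carrier G\<rparr>)"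
    using chi_subgroup_strict_mono[OF fin] triv_subgroup subgroup_self by blast+
  then show False using assms(3) by simp
qed

text \<open>Commutativity concerns two elements at a time, so it can be checked in the subgroups generated by
  two elements.\<close>

lemma (in group) nilpotent_imp_comm_group:
  assumes fin: "finite (carrier G)" and gen: "generating_number G = chi G" and nil: "nilpotent_group G"
  shows "comm_group G"
proof (rule group_comm_groupI)
  fix x y assume xy: "x \<in> carrier G" "y \<in> carrier G"
  let ?H = "generate G {x, y}"
  have H: "subgroup ?H G" using generate_is_subgroup[of "{x,y}"] xy by auto
  interpret H: group "G\<lparr>carrier := ?H\<rparr>" using subgroup.subgroup_is_group[OF H is_group] .
  have "chi (G\<lparr>carrier := ?H\<rparr>) \<le> card {x, y}"
    using chi_generate_le_card[OF fin gen, of "{x,y}"] xy by auto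
  also have "\<dots> \<le> 2" by (simp add: card_insert_if)
  finally have "chi (G\<lparr>carrier := ?H\<rparr>) \<le> 2" .
  moreover have "finite ?H" using subgroup.subset[OF H] fin finite_subset by blast
  moreover have "x \<in> ?H" "y \<in> ?H" by (auto intro: generate.incl)
  ultimately show "x \<otimes> y = y \<otimes> x"
    using H.nilpotent_chi_le_2_commutes[OF _ nilpotent_subgroup[OF nil H]] by simp
qed

lemma comm_group_imp_nilpotent:
  assumes "comm_group G"
  shows "nilpotent_group G"
proof -
  interpret comm_group G by fact
  have "x \<otimes>\<^bsub>G\<^esub> y \<otimes>\<^bsub>G\<^esub> inv\<^bsub>G\<^esub> x \<otimes>\<^bsub>G\<^esub> inv\<^bsub>G\<^esub> y = \<one>\<^bsub>G\<^esub>"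
    if "x \<in> carrier G" "y \<in> carrier G" for x y
    using that by (simp add: m_ac) (metis inv_closed l_inv m_closed m_lcomm r_inv r_one)
  then have "{x \<otimes>\<^bsub>G\<^esub> y \<otimes>\<^bsub>G\<^esub> inv\<^bsub>G\<^esub> x \<otimes>\<^bsub>G\<^esub> inv\<^bsub>G\<^esub> y | x y. x \<in> carrier G \<and> y \<in> carrier G}
      \<subseteq> {\<one>\<^bsub>G\<^esub>}" by auto
  then have "lower_central G 1 \<subseteq> {\<one>\<^bsub>G\<^esub>}"
    using generate_subgroup_incl[OF _ triv_subgroup] by simp
  then have "lower_central G 1 = {\<one>\<^bsub>G\<^esub>}" using one_in_lower_central[of 1] by blast
  then show ?thesis unfolding nilpotent_group_def using is_group by blast
qed

section \<open>Elementary abelian groups\<close>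

text \<open>Raising \<open>x y\<close> to the power \<open>ord x \<cdot> ord (x y)\<close> annihilates both \<open>x y\<close> and \<open>x\<close>, and therefore \<open>y\<close>;
  hence \<open>ord y\<close> divides \<open>ord x \<cdot> ord (x y)\<close>, and symmetrically. If \<open>ord x\<close> and \<open>ord y\<close> were distinct primes, the prime
  \<open>ord (x y)\<close> would have to equal both.\<close>

lemma (in comm_group) prime_orders_equal:
  assumes prime: "\<And>x. x \<in> carrier G \<Longrightarrow> x \<noteq> \<one> \<Longrightarrow> Factorial_Ring.prime (ord x)"
    and x: "x \<in> carrier G" "x \<noteq> \<one>" and y: "y \<in> carrier G" "y \<noteq> \<one>"
  shows "ord x = ord y"
proof (cases "x \<otimes> y = \<one>")
  case True
  then show ?thesis using x y ord_inv inv_equality by metis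
next
  case False
  have dvd: "ord b dvd ord a * ord (a \<otimes> b)"
    if a: "a \<in> carrier G" and b: "b \<in> carrier G" for a b
  proof -
    have "(a \<otimes> b) [^] (ord a * ord (a \<otimes> b)) = \<one>"
      using a b pow_eq_id by simp
    moreover have "(a \<otimes> b) [^] (ord a * ord (a \<otimes> b))
        = a [^] (ord a * ord (a \<otimes> b)) \<otimes> b [^] (ord a * ord (a \<otimes> b))"
      by (rule pow_mult_distrib) (use a b m_comm in auto)
    moreover have "a [^] (ord a * ord (a \<otimes> b)) = \<one>" using a pow_eq_id by simp
    ultimately show ?thesis using a b pow_eq_id by (metis l_one nat_pow_closed)
  qed
  have p: "Factorial_Ring.prime (ord x)" "Factorial_Ring.prime (ord y)"
    "Factorial_Ring.prime (ord (x \<otimes> y))"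
    using prime x y False by auto
  have "ord y dvd ord x * ord (x \<otimes> y)" "ord x dvd ord y * ord (x \<otimes> y)"
    using dvd[OF x(1) y(1)] dvd[OF y(1) x(1)] x y by (auto simp: m_comm)
  then show ?thesis using p by (metis prime_dvd_mult_iff primes_dvd_imp_eq)
qed

text \<open>By the first isomorphism theorem the image has as many elements as the kernel has cosets.\<close>

lemma (in group_hom) card_image_dvd_order: "card (h ` carrier G) dvd order G"
proof -
  have "card (rcosets kernel G H h) * card (kernel G H h) = order G"
    by (rule G.lagrange[OF subgroup_kernel])
  moreover have "card (rcosets kernel G H h) = card (h ` carrier G)"
  proof -
    interpret I: group "H\<lparr>carrier := h ` carrier G\<rparr>"
      using subgroup.subgroup_is_group[OF img_is_subgroup H.is_group] .
    \<comment> \<open>The isomorphism theorem is stated for surjective homomorphisms, so the target is cut down to the image.\<close>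
    have "group_hom G (H\<lparr>carrier := h ` carrier G\<rparr>) h"
      by unfold_locales (auto simp: hom_def)
    then interpret I: group_hom G "H\<lparr>carrier := h ` carrier G\<rparr>" h .
    have "(\<lambda>X. the_elem (h ` X)) \<in> iso (G Mod kernel G (H\<lparr>carrier := h ` carrier G\<rparr>) h) (H\<lparr>carrier := h ` carrier G\<rparr>)"
      by (rule I.FactGroup_iso_set) simp
    then show ?thesis
      by (auto simp: iso_def FactGroup_def kernel_def dest: bij_betw_same_card)
  qed
  ultimately show ?thesis by (metis dvd_triv_left)
qed

text \<open>The map sends a tuple of exponents to the corresponding product of powers of the generators; it is
  well behaved modulo \<open>p\<close> because \<open>p\<close> annihilates \<open>G\<close>.\<close>

lemma (in comm_group) elementary_abelian_epimorphism:
  assumes p: "p > 0" and exp: "\<And>x. x \<in> carrier G \<Longrightarrow> x [^] p = \<one>"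
    and S: "S \<subseteq> carrier G" "finite S" "generate G S = carrier G"
  obtains f where "f \<in> epi (product_group {..<card S} (\<lambda>_. integer_mod_group p)) G"
proof -
  let ?I = "{..<card S}"
  let ?P = "product_group ?I (\<lambda>_. integer_mod_group p)"
  obtain s where s: "bij_betw s ?I S"
    using S(2) ex_bij_betw_nat_finite by (metis atLeast0LessThan)
  have sG: "s i \<in> carrier G" if "i < card S" for i
    using s S(1) that by (auto simp: bij_betw_def)
  define f where "f a = (\<Otimes>i\<in>?I. s i [^] (a i :: int))" for a
  have modp: "x [^] (k mod int p) = x [^] k" if "x \<in> carrier G" for x and k :: int
  proof -
    have "x [^] (k mod int p) = x [^] (k mod int p) \<otimes> (x [^] int p) [^] (k div int p)"
      using that exp by (simp add: int_pow_int)
    also have "\<dots> = x [^] k"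
      using that by (simp add: int_pow_pow int_pow_mult[symmetric])
    finally show ?thesis .
  qed
  have hom: "f \<in> hom ?P G"
  proof (rule homI)
    fix a b
    have "f (a \<otimes>\<^bsub>?P\<^esub> b) = (\<Otimes>i\<in>?I. s i [^] a i \<otimes> s i [^] b i)"
      unfolding f_def by (rule finprod_cong') (auto simp: sG modp int_pow_mult)
    then show "f (a \<otimes>\<^bsub>?P\<^esub> b) = f a \<otimes> f b" unfolding f_def by (simp add: sG)
  qed (auto simp: f_def sG)
  interpret P: group ?P by simp
  interpret f: group_hom ?P G f by unfold_locales (rule hom)
  have "S \<subseteq> f ` carrier ?P"
  proof
    fix x assume "x \<in> S"
    then obtain i where i: "i < card S" "x = s i" using s by (auto simp: bij_betw_def)
    \<comment> \<open>The unit vector at \<open>i\<close>; its entry is \<open>1 mod p\<close>, so that it lies in the carrier even for \<open>p = 1\<close>.\<close>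
    define a where "a = (\<lambda>j\<in>?I. if j = i then 1 mod int p else 0)"
    have "f a = (\<Otimes>j\<in>?I. if j = i then s j else \<one>)"
      unfolding f_def a_def by (rule finprod_cong') (auto simp: sG modp)
    also have "\<dots> = x" using i by (subst finprod_singleton_swap) (auto simp: sG)
    finally have "f a = x" .
    moreover have "a \<in> carrier ?P" using p by (auto simp: a_def carrier_integer_mod_group)
    ultimately show "x \<in> f ` carrier ?P" by blast
  qed
  then have "generate G S \<subseteq> f ` carrier ?P" by (rule generate_subgroup_incl[OF _ f.img_is_subgroup])
  then have "f ` carrier ?P = carrier G"
    using S(3) subgroup.subset[OF f.img_is_subgroup] by blast
  then have "f \<in> epi ?P G" using hom unfolding epi_def by blast
  then show thesis by (rule that)
qed

text \<open>The surjection from \<open>p\<^sup>n\<close> tuples, \<open>n = \<chi>(G)\<close>, makes \<open>|G|\<close> a power of \<open>p\<close>. The exponent of that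
  power is \<open>\<chi>(G) = n\<close> again, so the surjection is between finite sets of equal size.\<close>

lemma (in comm_group) elementary_abelian_iso:
  assumes fin: "finite (carrier G)" and gen: "generating_number G = chi G"
    and p: "Factorial_Ring.prime p" and exp: "\<And>x. x \<in> carrier G \<Longrightarrow> x [^] p = \<one>"
  shows "G \<cong> product_group {..<chi G} (\<lambda>_. integer_mod_group p)" (is "G \<cong> ?P")
proof -
  have "p > 0" using p prime_gt_0_nat by blast
  obtain S where S: "S \<subseteq> carrier G" "generate G S = carrier G" "finite S" "card S = chi G"
    using generating_number_attained[OF fin] gen by auto
  obtain f where f: "f \<in> epi ?P G"
    using elementary_abelian_epimorphism[OF \<open>p > 0\<close> exp S(1,3,2)] S(4) by auto
  interpret P: group ?P by simp
  interpret f: group_hom ?P G f by unfold_locales (use f in \<open>simp add: epi_def\<close>)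
  have img: "f ` carrier ?P = carrier G" using f by (simp add: epi_def)
  have card: "order ?P = p ^ chi G"
    using \<open>p > 0\<close> by (simp add: order_def card_PiE carrier_integer_mod_group)
  have "order G dvd p ^ chi G" using f.card_image_dvd_order card img by (simp add: order_def)
  then obtain m where m: "order G = p ^ m" using p by (auto simp: divides_primepow_nat)
  then have "chi G = m" using p by (simp add: chi_eq_size prime_factorization_prime_power)
  then have "card (f ` carrier ?P) = card (carrier ?P)"
    using m card img by (simp add: order_def)
  moreover have "finite (carrier ?P)"
    using card \<open>p > 0\<close> P.order_gt_0_iff_finite by simp
  ultimately have "inj_on f (carrier ?P)" by (rule eq_card_imp_inj_on[rotated])
  then have "f \<in> iso ?P G" using f.homh img by (simp add: iso_iff)
  then have "?P \<cong> G" by (auto simp: is_iso_def)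
  then show ?thesis by (rule P.iso_sym)
qed

lemma comm_group_product_integer_mod_group:
  "comm_group (product_group I (\<lambda>_. integer_mod_group p))" (is "comm_group ?P")
proof -
  interpret group ?P by simp
  show ?thesis
  proof (rule group_comm_groupI)
    fix a b
    show "a \<otimes>\<^bsub>?P\<^esub> b = b \<otimes>\<^bsub>?P\<^esub> a"
      unfolding mult_product_group mult_integer_mod_group
      by (rule restrict_ext) (simp only: add.commute)
  qed
qed

theorem theorem5p10:
  fixes G :: "('a, 'b) monoid_scheme"
  assumes "group G"
    and "finite (carrier G)"
    and "order G \<ge> 2"
  shows "determining_number G \<le> chi G \<and>
    (determining_number G = chi G \<longrightarrow>
      (\<forall>H. subgroup H G \<longrightarrow>
         generating_number (G\<lparr>carrier := H\<rparr>) = chi (G\<lparr>carrier := H\<rparr>)) \<and>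
      (\<forall>x \<in> carrier G. x \<noteq> \<one>\<^bsub>G\<^esub> \<longrightarrow> Factorial_Ring.prime (group.ord G x)) \<and>
      (nilpotent_group G \<longleftrightarrow>
         (\<exists>p::nat. Factorial_Ring.prime p \<and>
            G \<cong> product_group {..<chi G} (\<lambda>_. integer_mod_group p))))"
proof -
  interpret group G by fact
  note fin = assms(2)
  have le: "determining_number G \<le> generating_number G" "generating_number G \<le> chi G"
    using determining_number_le_generating_number[OF fin] generating_number_le_chi[OF fin] .
  show ?thesis
  proof (intro conjI impI allI ballI)
    show "determining_number G \<le> chi G" using le by simp
  next
    assume eq: "determining_number G = chi G"
    then have gen: "generating_number G = chi G" using le by simp
    show "generating_number (G\<lparr>carrier := H\<rparr>) = chi (G\<lparr>carrier := H\<rparr>)" if "subgroup H G" for H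
      using generating_number_subgroup_eq_chi[OF fin gen that] .
    show prime: "Factorial_Ring.prime (ord x)" if "x \<in> carrier G" "x \<noteq> \<one>\<^bsub>G\<^esub>" for x
      using prime_order_elements[OF fin gen that] .
    show "nilpotent_group G \<longleftrightarrow> (\<exists>p::nat. Factorial_Ring.prime p \<and>
        G \<cong> product_group {..<chi G} (\<lambda>_. integer_mod_group p))"
    proof
      assume "nilpotent_group G"
      then interpret comm_group G by (rule nilpotent_imp_comm_group[OF fin gen])
      have "carrier G \<noteq> {\<one>\<^bsub>G\<^esub>}" using assms(3) by (auto simp: order_def)
      then obtain a where a: "a \<in> carrier G" "a \<noteq> \<one>\<^bsub>G\<^esub>" using one_closed by blast
      have "x [^]\<^bsub>G\<^esub> ord a = \<one>\<^bsub>G\<^esub>" if "x \<in> carrier G" for x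
      proof (cases "x = \<one>\<^bsub>G\<^esub>")
        case False
        then have "ord a = ord x" using prime_orders_equal[OF prime a that] by simp
        then show ?thesis using that by simp
      qed simp
      then show "\<exists>p::nat. Factorial_Ring.prime p \<and>
          G \<cong> product_group {..<chi G} (\<lambda>_. integer_mod_group p)"
        using elementary_abelian_iso[OF fin gen prime[OF a]] prime[OF a] by blast
    next
      assume "\<exists>p::nat. Factorial_Ring.prime p \<and>
        G \<cong> product_group {..<chi G} (\<lambda>_. integer_mod_group p)"
      then show "nilpotent_group G"
        using comm_group.iso_imp_comm_group[OF comm_group_product_integer_mod_group iso_sym is_monoid]
          comm_group_imp_nilpotent by blast
    qed
  qed
qed

end
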